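(* For $m\in\frac12\mathbb N$ the following formula holds: $$\begin{aligned} &\sum_{j\in\mathbb Z}q^{(m+1)j^2}e^{-2\pi ij(z_1-z_2)+2\pi ijm(z_1-z_3)}\,\Phi^{[m,0]}(\tau,z_1,-z_3+2j\tau,0)\\ &-\sum_{j\in\mathbb Z}q^{(m+1)j^2}e^{2\pi ij(z_1-z_2)+2\pi ijm(z_1-z_3)}\,\Phi^{[m,0]}(\tau,z_2,z_1-z_2-z_3+2j\tau,0)\\ &=\sum_{j\in\mathbb Z}q^{(m+1)j^2}e^{2\pi ij(z_1-z_2)-2\pi ijm(z_1-z_3)}\,\Phi^{[1,0]}(\tau,z_1,-z_2+2j\tau,0)\\ &\quad-\sum_{j\in\mathbb Z}q^{(m+1)j^2}e^{2\pi ij(z_1-z_2)+2\pi ijm(z_1-z_3)}\,\Phi^{[1,0]}(\tau,z_3,z_1-z_2-z_3+2j\tau,0). \end{aligned}$$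
   Context: $\mathbb N$ is the set of positive integers; $\tau$ lies in the upper half-plane, $z_1,z_2,z_3,t\in\mathbb C$, $q=e^{2\pi i\tau}$. For $m\in\frac12\mathbb N$, $s\in\frac12\mathbb Z$: $$\Phi^{[m,s]}_1(\tau,z_1,z_2,t)=e^{-2\pi imt}\sum_{j\in\mathbb Z}\frac{e^{2\pi imj(z_1+z_2)+2\pi isz_1}q^{mj^2+sj}}{1-e^{2\pi iz_1}q^j},\qquad \Phi^{[m,s]}_2(\tau,z_1,z_2,t)=e^{-2\pi imt}\sum_{j\in\mathbb Z}\frac{e^{-2\pi imj(z_1+z_2)-2\pi isz_2}q^{mj^2+sj}}{1-e^{-2\pi iz_2}q^j},$$ $\Phi^{[m,s]}=\Phi^{[m,s]}_1-\Phi^{[m,s]}_2$. Identities are identities of meromorphic functions of the variables. *)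

theory Defs
  imports "HOL-Analysis.Analysis"
begin

definition expi :: "complex \<Rightarrow> complex" where
  "expi z = exp (2 * of_real pi * \<i> * z)"

(* With q = exp (2 pi i tau), the exponents of q may be half-integral: q^x always means
   exp (2 pi i x tau), so it depends on the choice of tau and not only on q. *)
definition qpow :: "complex \<Rightarrow> real \<Rightarrow> complex" where
  "qpow \<tau> x = expi (of_real x * \<tau>)"

(* The positive half-integers: halves of the integers k >= 1. *)
definition half_pos_nats :: "real set" where
  "half_pos_nats = {real k / 2 | k::nat. k \<ge> 1}"

definition period_lattice :: "complex \<Rightarrow> complex set" where
  "period_lattice \<tau> = {of_int a + of_int b * \<tau> | a b :: int. True}"

(* Both series are meant for m a positive half-integer, s a half-integer and Im tau > 0.
   They converge absolutely unless a denominator vanishes, i.e. for z1 (resp. z2)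
   outside the period lattice, so the infinite sums take their genuine values there. *)
definition Phi1 ::
  "real \<Rightarrow> real \<Rightarrow> complex \<Rightarrow> complex \<Rightarrow> complex \<Rightarrow> complex \<Rightarrow> complex" where
  "Phi1 m s \<tau> z1 z2 t =
     expi (- (of_real m * t)) *
     (\<Sum>\<^sub>\<infinity>j\<in>(UNIV :: int set).
        expi (of_real m * of_int j * (z1 + z2) + of_real s * z1)
          * qpow \<tau> (m * (of_int j)^2 + s * of_int j)
        / (1 - expi z1 * qpow \<tau> (of_int j)))"

definition Phi2 ::
  "real \<Rightarrow> real \<Rightarrow> complex \<Rightarrow> complex \<Rightarrow> complex \<Rightarrow> complex \<Rightarrow> complex" where
  "Phi2 m s \<tau> z1 z2 t =
     expi (- (of_real m * t)) *
     (\<Sum>\<^sub>\<infinity>j\<in>(UNIV :: int set).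
        expi (- (of_real m * of_int j * (z1 + z2)) - of_real s * z2)
          * qpow \<tau> (m * (of_int j)^2 + s * of_int j)
        / (1 - expi (- z2) * qpow \<tau> (of_int j)))"

definition Phi ::
  "real \<Rightarrow> real \<Rightarrow> complex \<Rightarrow> complex \<Rightarrow> complex \<Rightarrow> complex \<Rightarrow> complex" where
  "Phi m s \<tau> z1 z2 t = Phi1 m s \<tau> z1 z2 t - Phi2 m s \<tau> z1 z2 t"

end

theory Submission
  imports Defs
begin

text \<open>
  Both sides are double series over the same lattice. Powers of \<open>q\<close> are taken through \<open>\<tau>\<close>; put
  \<open>a, b, c\<close> for the exponentials of \<open>2 \<pi> i z1\<close>, \<open>2 \<pi> i z2\<close>, \<open>2 \<pi> i z3\<close>. Replacing \<open>k\<close> by \<open>-k\<close> in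
  the second half of \<open>\<Phi>\<close> gives both halves the same Gaussian factor, so that \<open>\<Phi>\<close> is one Gaussian
  series whose coefficients are differences of two simple pole factors \<open>1 / (1 - u)\<close>. The shift of the second
  argument of \<open>\<Phi>\<close> by \<open>2 j \<tau>\<close> contributes a cross term \<open>2 m j k\<close> (level \<open>m\<close>) or \<open>2 j k\<close> (level \<open>1\<close>)
  to the exponent of \<open>q\<close>, and the quadratic forms become diagonal in \<open>j\<close> and \<open>j + k\<close>:
  \<open>(m + 1) j^2 + m k^2 + 2 m j k = j^2 + m (j + k)^2\<close> and
  \<open>(m + 1) j^2 + k^2 + 2 j k = m j^2 + (j + k)^2\<close>. Hence, with \<open>n = j + k\<close>, each of the four
  sums becomes a double series over \<open>(j, n)\<close> in which \<open>j\<close> and \<open>n\<close> only interact through the pole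
  factors (\<open>infsum_Phi_eq_double_infsum\<close>).

  After renaming the indices (signs and order), all four series carry the same weight
  \<open>q^(p^2 + m r^2) (a/b)^p (a/c)^(m r)\<close>, and with
    \<open>A = 1 / (1 - a q^(p+r))\<close>, \<open>B = 1 / (1 - b q^(r-p))\<close>, \<open>C = 1 / (1 - c q^(p-r))\<close>,
    \<open>D = 1 / (1 - (b c / a) q^(-p-r))\<close>
  the coefficients on the left are \<open>(A - C) - (B - D)\<close>, those on the right
  \<open>(A - B) - (C - D)\<close>: the two sides agree term by term (\<open>pole_term_exchange\<close>).

  Rearranging the series is legitimate because they converge absolutely: the weight is Gaussian
  (\<open>gauss_abs_summable\<close>), and the pole factors are bounded along each coset of \<open>\<int>\<tau>\<close>
  (\<open>pole_bounded\<close>).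
\<close>

section \<open>Exponentials and Gaussian weights\<close>

lemma expi_add: "expi (a + b) = expi a * expi b"
  unfolding expi_def by (simp add: exp_add ring_distribs)

lemma norm_expi: "norm (expi z) = exp (- (2 * pi * Im z))"
  unfolding expi_def by (simp add: norm_exp_eq_Re)

text \<open>The general term \<open>q^(\<alpha> n^2) exp (2 \<pi> i \<alpha> n x)\<close> of a theta series of index \<open>\<alpha>\<close>.\<close>

definition gauss :: "real \<Rightarrow> complex \<Rightarrow> complex \<Rightarrow> int \<Rightarrow> complex" where
  "gauss \<alpha> \<tau> x n = expi (of_real \<alpha> * (of_int n ^ 2 * \<tau> + of_int n * x))"

lemma gauss_minus: "gauss \<alpha> \<tau> x (- n) = gauss \<alpha> \<tau> (- x) n"
  unfolding gauss_def by simp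

lemma exp_minus_abs_summable_on_int: "(\<lambda>n::int. exp (- \<bar>real_of_int n\<bar>)) summable_on UNIV"
proof -
  let ?f = "\<lambda>n::int. exp (- \<bar>real_of_int n\<bar>)"
  have geo: "(\<lambda>n. ?f (int n)) summable_on UNIV"
  proof (rule norm_summable_imp_summable_on)
    have "summable (\<lambda>n. exp (-1::real) ^ n)"
      by (rule summable_geometric) simp
    then show "summable (\<lambda>n. norm (?f (int n)))"
      by (simp add: exp_of_nat_mult[symmetric])
  qed
  have pos: "?f summable_on range int"
    using geo by (subst summable_on_reindex) (auto simp: o_def)
  have neg: "?f summable_on range (\<lambda>n. - int n)"
    using geo by (subst summable_on_reindex) (auto simp: o_def inj_on_def)
  have "?f summable_on (range int \<union> (range (\<lambda>n. - int n) - range int))"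
    by (rule summable_on_Un_disjoint[OF pos summable_on_subset_banach[OF neg]]) auto
  moreover have "range int \<union> (range (\<lambda>n. - int n) - range int) = UNIV"
    by (auto simp: image_iff) (metis int_cases2)
  ultimately show ?thesis by simp
qed

text \<open>
  The norm of the weight is \<open>exp (- (A n^2 + B n))\<close> with \<open>A > 0\<close>. Completing a square bounds it
  by a multiple of \<open>exp (- \<bar>n\<bar>)\<close>, hence by two geometric series.
\<close>

lemma gauss_abs_summable:
  assumes "\<alpha> > 0" "Im \<tau> > 0"
  shows "(\<lambda>n. norm (gauss \<alpha> \<tau> x n)) summable_on UNIV"
proof -
  define A where "A = 2 * pi * \<alpha> * Im \<tau>"
  define B where "B = 2 * pi * \<alpha> * Im x"
  have A: "A > 0" unfolding A_def using assms by simp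
  have norm_eq: "norm (gauss \<alpha> \<tau> x n) = exp (- (A * real_of_int n ^ 2 + B * real_of_int n))" for n
    unfolding gauss_def norm_expi A_def B_def
    by (simp add: algebra_simps power2_eq_square)
  \<comment> \<open>\<open>C\<close> is the maximum of \<open>(\<bar>B\<bar> + 1) t - A t^2\<close> over real \<open>t\<close>.\<close>
  define C where "C = (\<bar>B\<bar> + 1)^2 / (4 * A)"
  have le: "norm (gauss \<alpha> \<tau> x n) \<le> exp C * exp (- \<bar>real_of_int n\<bar>)" for n
  proof -
    let ?t = "\<bar>real_of_int n\<bar>"
    have "0 \<le> (2 * A * ?t - (\<bar>B\<bar> + 1))^2 / (4 * A)" using A by simp
    also have "\<dots> = A * ?t^2 - (\<bar>B\<bar> + 1) * ?t + C"
      unfolding C_def using A by (simp add: field_simps power2_eq_square)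
    finally have "(\<bar>B\<bar> + 1) * ?t \<le> A * ?t^2 + C" by simp
    moreover have "- (B * real_of_int n) \<le> \<bar>B\<bar> * ?t"
      by (metis abs_ge_minus_self abs_mult)
    ultimately have "- (A * real_of_int n ^ 2 + B * real_of_int n) \<le> C + - ?t"
      by (simp add: algebra_simps)
    then show ?thesis unfolding norm_eq exp_add[symmetric] by simp
  qed
  show ?thesis
    by (rule Infinite_Sum.abs_summable_on_comparison_test'[OF summable_on_cmult_right[OF exp_minus_abs_summable_on_int] le])
qed

section \<open>The pole factors\<close>

definition pole :: "complex \<Rightarrow> complex" where
  "pole z = 1 / (1 - expi z)"

text \<open>
  Along \<open>z + n \<tau>\<close> the modulus of the exponential tends to \<open>0\<close> in one direction and to \<open>\<infinity>\<close> in the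
  other, so all but finitely many values of \<open>1 - exp (2 \<pi> i (z + n \<tau>))\<close> have modulus at least
  \<open>1 / 2\<close>. The finitely many remaining terms are just added up; should one of them sit at a pole,
  division by zero makes it \<open>0\<close>.
\<close>

lemma pole_bounded:
  assumes "Im \<tau> > 0"
  obtains M where "\<And>n::int. norm (pole (z + of_int n * \<tau>)) \<le> M"
proof -
  define S where "S = {n::int. \<bar>Im z + of_int n * Im \<tau>\<bar> < 1}"
  have "S \<subseteq> {\<lfloor>(- 1 - Im z) / Im \<tau>\<rfloor>..\<lceil>(1 - Im z) / Im \<tau>\<rceil>}"
  proof
    fix n assume "n \<in> S"
    then have "- 1 - Im z < of_int n * Im \<tau>" "of_int n * Im \<tau> < 1 - Im z"
      unfolding S_def by auto
    then have "(- 1 - Im z) / Im \<tau> < of_int n" "of_int n < (1 - Im z) / Im \<tau>"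
      using assms by (simp_all add: field_simps)
    then show "n \<in> {\<lfloor>(- 1 - Im z) / Im \<tau>\<rfloor>..\<lceil>(1 - Im z) / Im \<tau>\<rceil>}"
      by (simp add: le_ceiling_iff floor_le_iff)
  qed
  then have fin: "finite S" by (rule finite_subset) simp
  have far: "norm (pole (z + of_int n * \<tau>)) \<le> 2" if "n \<notin> S" for n
  proof -
    define u where "u = expi (z + of_int n * \<tau>)"
    define s where "s = 2 * pi * (Im z + of_int n * Im \<tau>)"
    have nu: "norm u = exp (- s)" unfolding u_def norm_expi s_def by simp
    have "1 * 1 \<le> (2 * pi) * \<bar>Im z + of_int n * Im \<tau>\<bar>"
      using that pi_ge_two unfolding S_def by (intro mult_mono) auto
    then have s: "\<bar>s\<bar> \<ge> 1" unfolding s_def by (simp add: abs_mult)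
    have half: "1 / 2 \<le> norm (1 - u)"
    proof (cases "s \<ge> 0")
      case True
      have "exp s \<ge> 2" using exp_ge_add_one_self[of s] s True by linarith
      then have "norm u \<le> 1 / 2" unfolding nu exp_minus by (simp add: field_simps)
      then show ?thesis using norm_triangle_ineq2[of 1 u] by simp
    next
      case False
      have "norm u \<ge> 2" unfolding nu using exp_ge_add_one_self[of "- s"] s False by linarith
      then show ?thesis using norm_triangle_ineq2[of u 1] by (simp add: norm_minus_commute)
    qed
    have "norm (pole (z + of_int n * \<tau>)) = 1 / norm (1 - u)"
      unfolding pole_def u_def by (simp add: norm_divide)
    also have "\<dots> \<le> 1 / (1 / 2)" using half by (intro divide_left_mono) auto
    finally show ?thesis by simp
  qed
  define M where "M = 2 + (\<Sum>n\<in>S. norm (pole (z + of_int n * \<tau>)))"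
  have "norm (pole (z + of_int n * \<tau>)) \<le> M" for n
  proof (cases "n \<in> S")
    case True
    have "norm (pole (z + of_int n * \<tau>)) \<le> (\<Sum>n\<in>S. norm (pole (z + of_int n * \<tau>)))"
      by (rule member_le_sum[OF True _ fin]) simp
    then show ?thesis unfolding M_def by simp
  next
    case False
    have "0 \<le> (\<Sum>n\<in>S. norm (pole (z + of_int n * \<tau>)))" by (rule sum_nonneg) simp
    then show ?thesis using far[OF False] unfolding M_def by simp
  qed
  then show thesis by (rule that)
qed

lemma summable_on_mult_bounded:
  fixes f g :: "'a \<Rightarrow> complex"
  assumes "(\<lambda>x. norm (f x)) summable_on A" and "\<And>x. norm (g x) \<le> M"
  shows "(\<lambda>x. f x * g x) summable_on A"
proof (rule abs_summable_summable, rule Infinite_Sum.abs_summable_on_comparison_test')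
  show "(\<lambda>x. norm (f x) * M) summable_on A"
    by (rule summable_on_cmult_left[OF assms(1)])
  show "norm (f x * g x) \<le> norm (f x) * M" for x
    unfolding norm_mult by (rule mult_left_mono[OF assms(2)]) simp
qed

lemma infsum_diff:
  fixes f g :: "'a \<Rightarrow> 'b::{topological_ab_group_add, t2_space}"
  assumes "f summable_on A" "g summable_on A"
  shows "(\<Sum>\<^sub>\<infinity>x\<in>A. f x - g x) = infsum f A - infsum g A"
  using infsum_add[of f A "\<lambda>x. - g x"] assms by (simp add: summable_on_uminus infsum_uminus)

text \<open>
  The two halves of \<open>\<Phi>\<close> have mutually inverse exponential factors; reflecting the
  index of the second half makes the factors equal, at the price of \<open>q^(-k)\<close> in its denominator.
  The second argument is written as \<open>y - z\<close> since only its sum with \<open>z\<close> enters the weight.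
\<close>

lemma Phi_eq_infsum_pole_diff:
  assumes "\<mu> > 0" "Im \<tau> > 0"
  shows "Phi \<mu> 0 \<tau> z (y - z) 0 =
    (\<Sum>\<^sub>\<infinity>k\<in>UNIV. gauss \<mu> \<tau> y k * (pole (z + of_int k * \<tau>) - pole (z - y - of_int k * \<tau>)))"
proof -
  obtain M1 where M1: "\<And>n::int. norm (pole (z + of_int n * \<tau>)) \<le> M1"
    using pole_bounded[OF assms(2)] by blast
  obtain M2 where M2: "\<And>n::int. norm (pole (z - y + of_int n * \<tau>)) \<le> M2"
    using pole_bounded[OF assms(2)] by blast
  have M2': "norm (pole (z - y - of_int n * \<tau>)) \<le> M2" for n :: int
    using M2[of "- n"] by simp
  note gs = gauss_abs_summable[OF assms, of y]
  note sum1 = summable_on_mult_bounded[OF gs M1]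
  note sum2 = summable_on_mult_bounded[OF gs M2']
  have P1: "Phi1 \<mu> 0 \<tau> z (y - z) 0 = (\<Sum>\<^sub>\<infinity>k\<in>UNIV. gauss \<mu> \<tau> y k * pole (z + of_int k * \<tau>))"
    unfolding Phi1_def gauss_def qpow_def pole_def
    by (simp add: expi_def exp_add[symmetric] algebra_simps)
  have "Phi2 \<mu> 0 \<tau> z (y - z) 0 =
      (\<Sum>\<^sub>\<infinity>k\<in>UNIV. gauss \<mu> \<tau> y (- k) * pole (z - y - of_int (- k) * \<tau>))"
    unfolding Phi2_def gauss_def qpow_def pole_def
    by (simp add: expi_def exp_add[symmetric] algebra_simps)
  also have "\<dots> = (\<Sum>\<^sub>\<infinity>k\<in>UNIV. gauss \<mu> \<tau> y k * pole (z - y - of_int k * \<tau>))"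
    by (rule infsum_reindex_bij_betw[OF bij_uminus])
  finally have P2: "Phi2 \<mu> 0 \<tau> z (y - z) 0 = \<dots>" .
  show ?thesis
    unfolding Phi_def P1 P2 right_diff_distrib by (rule infsum_diff[symmetric, OF sum1 sum2])
qed

section \<open>Unfolding into a double series\<close>

text \<open>
  The weights for the outer level \<open>\<nu>\<close> and the inner level \<open>\<mu>\<close> are kept separate because the
  levels \<open>m\<close> and \<open>1\<close> swap roles between the two sides of the identity.
\<close>

definition pole_term ::
  "real \<Rightarrow> real \<Rightarrow> complex \<Rightarrow> complex \<Rightarrow> complex \<Rightarrow> complex \<Rightarrow> int \<times> int \<Rightarrow> complex" where
  "pole_term \<nu> \<mu> \<tau> x y z = (\<lambda>(j, n). gauss \<nu> \<tau> x j * gauss \<mu> \<tau> y n *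
     (pole (z + of_int (n - j) * \<tau>) - pole (z - y - of_int (n + j) * \<tau>)))"

lemma pole_term_summable:
  assumes "\<nu> > 0" "\<mu> > 0" "Im \<tau> > 0"
  shows "pole_term \<nu> \<mu> \<tau> x y z summable_on UNIV"
proof -
  obtain M1 where M1: "\<And>n::int. norm (pole (z + of_int n * \<tau>)) \<le> M1"
    using pole_bounded[OF assms(3)] by blast
  obtain M2 where M2: "\<And>n::int. norm (pole (z - y + of_int n * \<tau>)) \<le> M2"
    using pole_bounded[OF assms(3)] by blast
  define g where "g = (\<lambda>(j, n). pole (z + of_int (n - j) * \<tau>) - pole (z - y - of_int (n + j) * \<tau>))"
  have bound: "norm (g p) \<le> M1 + M2" for p
  proof (cases p)
    case (Pair j n)
    have "norm (g p) \<le> norm (pole (z + of_int (n - j) * \<tau>)) + norm (pole (z - y + of_int (- (n + j)) * \<tau>))"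
      unfolding g_def Pair
      using norm_triangle_ineq4[of "pole (z + of_int (n - j) * \<tau>)" "pole (z - y - of_int (n + j) * \<tau>)"]
      by (simp add: algebra_simps)
    then show ?thesis using M1[of "n - j"] M2[of "- (n + j)"] by linarith
  qed
  have prod: "(\<lambda>p. norm (gauss \<nu> \<tau> x (fst p) * gauss \<mu> \<tau> y (snd p))) summable_on UNIV \<times> UNIV"
    by (subst Infinite_Sum.abs_summable_on_Sigma_iff)
      (simp add: norm_mult abs_mult infsum_cmult_right' infsum_nonneg
        summable_on_cmult_right summable_on_cmult_left gauss_abs_summable assms)
  have "(\<lambda>p. (gauss \<nu> \<tau> x (fst p) * gauss \<mu> \<tau> y (snd p)) * g p) summable_on UNIV"
    using summable_on_mult_bounded[OF prod bound] by simp
  then show ?thesis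
    unfolding pole_term_def g_def by (simp add: case_prod_unfold)
qed

text \<open>
  The index of the double series is \<open>n = j + k\<close>, where \<open>k\<close> is the summation index of \<open>\<Phi>\<close>: this
  diagonalizes the quadratic form, as
  \<open>(\<mu> + \<nu>) j^2 + \<mu> k^2 + 2 \<mu> j k = \<nu> j^2 + \<mu> (j + k)^2\<close>.
\<close>

lemma infsum_Phi_eq_double_infsum:
  assumes "\<nu> > 0" "\<mu> > 0" "Im \<tau> > 0"
  shows "(\<Sum>\<^sub>\<infinity>j\<in>(UNIV :: int set). qpow \<tau> ((\<mu> + \<nu>) * (of_int j)^2)
      * expi (of_int j * (of_real \<nu> * x + of_real \<mu> * y))
      * Phi \<mu> 0 \<tau> z (y - z + 2 * of_int j * \<tau>) 0) = infsum (pole_term \<nu> \<mu> \<tau> x y z) UNIV"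
proof -
  have inner: "qpow \<tau> ((\<mu> + \<nu>) * (of_int j)^2) * expi (of_int j * (of_real \<nu> * x + of_real \<mu> * y))
      * Phi \<mu> 0 \<tau> z (y - z + 2 * of_int j * \<tau>) 0 = (\<Sum>\<^sub>\<infinity>n\<in>UNIV. pole_term \<nu> \<mu> \<tau> x y z (j, n))"
    (is "?c * _ = _") for j :: int
  proof -
    have w: "y - z + 2 * of_int j * \<tau> = (y + 2 * of_int j * \<tau>) - z" by simp
    have "?c * Phi \<mu> 0 \<tau> z (y - z + 2 * of_int j * \<tau>) 0 =
        (\<Sum>\<^sub>\<infinity>k\<in>UNIV. ?c * (gauss \<mu> \<tau> (y + 2 * of_int j * \<tau>) k *
          (pole (z + of_int k * \<tau>) - pole (z - (y + 2 * of_int j * \<tau>) - of_int k * \<tau>))))"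
      unfolding w Phi_eq_infsum_pole_diff[OF assms(2,3)] by (rule infsum_cmult_right'[symmetric])
    also have "\<dots> = (\<Sum>\<^sub>\<infinity>k\<in>UNIV. pole_term \<nu> \<mu> \<tau> x y z (j, j + k))"
    proof (rule infsum_cong)
      fix k :: int
      have "?c * gauss \<mu> \<tau> (y + 2 * of_int j * \<tau>) k = gauss \<nu> \<tau> x j * gauss \<mu> \<tau> y (j + k)"
        unfolding gauss_def qpow_def expi_add[symmetric]
        by (rule arg_cong[of _ _ expi]) (simp add: algebra_simps power2_eq_square)
      moreover have arg: "z - (y + 2 * of_int j * \<tau>) - of_int k * \<tau> = z - y - of_int (j + k + j) * \<tau>"
        by (simp add: algebra_simps)
      ultimately show "?c * (gauss \<mu> \<tau> (y + 2 * of_int j * \<tau>) k *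
          (pole (z + of_int k * \<tau>) - pole (z - (y + 2 * of_int j * \<tau>) - of_int k * \<tau>))) =
        pole_term \<nu> \<mu> \<tau> x y z (j, j + k)"
        unfolding pole_term_def arg by (simp add: mult.assoc[symmetric])
    qed
    also have "\<dots> = (\<Sum>\<^sub>\<infinity>n\<in>UNIV. pole_term \<nu> \<mu> \<tau> x y z (j, n))"
      by (rule infsum_reindex_bij_betw) (rule bij_plus)
    finally show ?thesis .
  qed
  show ?thesis
    unfolding inner using infsum_Sigma_banach[of "pole_term \<nu> \<mu> \<tau> x y z" UNIV "\<lambda>_. UNIV"]
      pole_term_summable[OF assms] by simp
qed

section \<open>The identity\<close>

text \<open>
  At these indices the four terms have equal weights, and each of the four pole factors
  occurs once on either side with the same sign; only the pairing of the factors differs.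
\<close>

lemma pole_term_exchange:
  "pole_term 1 m \<tau> (z2 - z1) (z1 - z3) z1 (- p, r) - pole_term 1 m \<tau> (z1 - z2) (z1 - z3) z2 (p, r)
   = pole_term m 1 \<tau> (z3 - z1) (z1 - z2) z1 (- r, p) - pole_term m 1 \<tau> (z1 - z3) (z1 - z2) z3 (r, p)"
  unfolding pole_term_def by (simp add: gauss_minus algebra_simps)

theorem lemma3p1:
  fixes m :: real and \<tau> z1 z2 z3 :: complex
  assumes "m \<in> half_pos_nats"
    and "Im \<tau> > 0"
    and "z1 \<notin> period_lattice \<tau>"
    and "z2 \<notin> period_lattice \<tau>"
    and "z3 \<notin> period_lattice \<tau>"
    and "z1 - z2 - z3 \<notin> period_lattice \<tau>"
  shows
    "(\<Sum>\<^sub>\<infinity>j\<in>(UNIV :: int set).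
        qpow \<tau> ((m + 1) * (of_int j)^2)
        * expi (- (of_int j * (z1 - z2)) + of_int j * of_real m * (z1 - z3))
        * Phi m 0 \<tau> z1 (- z3 + 2 * of_int j * \<tau>) 0)
     - (\<Sum>\<^sub>\<infinity>j\<in>(UNIV :: int set).
        qpow \<tau> ((m + 1) * (of_int j)^2)
        * expi (of_int j * (z1 - z2) + of_int j * of_real m * (z1 - z3))
        * Phi m 0 \<tau> z2 (z1 - z2 - z3 + 2 * of_int j * \<tau>) 0)
     = (\<Sum>\<^sub>\<infinity>j\<in>(UNIV :: int set).
        qpow \<tau> ((m + 1) * (of_int j)^2)
        * expi (of_int j * (z1 - z2) - of_int j * of_real m * (z1 - z3))
        * Phi 1 0 \<tau> z1 (- z2 + 2 * of_int j * \<tau>) 0)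
     - (\<Sum>\<^sub>\<infinity>j\<in>(UNIV :: int set).
        qpow \<tau> ((m + 1) * (of_int j)^2)
        * expi (of_int j * (z1 - z2) + of_int j * of_real m * (z1 - z3))
        * Phi 1 0 \<tau> z3 (z1 - z2 - z3 + 2 * of_int j * \<tau>) 0)"
    (is "?S1 - ?S2 = ?S3 - ?S4")
proof -
  have m: "m > 0" using assms(1) unfolding half_pos_nats_def by auto
  define T1 where "T1 = pole_term 1 m \<tau> (z2 - z1) (z1 - z3) z1"
  define T2 where "T2 = pole_term 1 m \<tau> (z1 - z2) (z1 - z3) z2"
  define T3 where "T3 = pole_term m 1 \<tau> (z3 - z1) (z1 - z2) z1"
  define T4 where "T4 = pole_term m 1 \<tau> (z1 - z3) (z1 - z2) z3"
  note summ = pole_term_summable[OF zero_less_one m assms(2)] pole_term_summable[OF m zero_less_one assms(2)]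
  note unfold1 = infsum_Phi_eq_double_infsum[OF zero_less_one m assms(2)]
  note unfold2 = infsum_Phi_eq_double_infsum[OF m zero_less_one assms(2)]

  have "?S1 = infsum T1 UNIV"
    unfolding T1_def unfold1[symmetric] by (intro infsum_cong) (simp add: algebra_simps)
  moreover have "?S2 = infsum T2 UNIV"
    unfolding T2_def unfold1[symmetric] by (intro infsum_cong) (simp add: algebra_simps)
  moreover have "?S3 = infsum T3 UNIV"
    unfolding T3_def unfold2[symmetric] by (intro infsum_cong) (simp add: algebra_simps)
  moreover have "?S4 = infsum T4 UNIV"
    unfolding T4_def unfold2[symmetric] by (intro infsum_cong) (simp add: algebra_simps)
  moreover have "infsum T1 UNIV - infsum T2 UNIV = infsum T3 UNIV - infsum T4 UNIV"
  proof -
    \<comment> \<open>The substitutions that give all four series the weight of \<open>T2\<close> at \<open>(p, r)\<close>.\<close>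
    have b1: "bij (\<lambda>(p, r). (- p, r) :: int \<times> int)"
      by (rule o_bij[of "\<lambda>(p, r). (- p, r)"]) (auto simp: fun_eq_iff)
    have b3: "bij (\<lambda>(p, r). (- r, p) :: int \<times> int)"
      by (rule o_bij[of "\<lambda>(j, n). (n, - j)"]) (auto simp: fun_eq_iff)
    have b4: "bij (\<lambda>(p, r). (r, p) :: int \<times> int)"
      by (rule o_bij[of "\<lambda>(j, n). (n, j)"]) (auto simp: fun_eq_iff)
    let ?r1 = "\<lambda>q. T1 (case q of (p, r) \<Rightarrow> (- p, r))"
    let ?r3 = "\<lambda>q. T3 (case q of (p, r) \<Rightarrow> (- r, p))"
    let ?r4 = "\<lambda>q. T4 (case q of (p, r) \<Rightarrow> (r, p))"
    have s: "?r1 summable_on UNIV" "T2 summable_on UNIV" "?r3 summable_on UNIV" "?r4 summable_on UNIV"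
      unfolding summable_on_reindex_bij_betw[OF b1] summable_on_reindex_bij_betw[OF b3]
        summable_on_reindex_bij_betw[OF b4] T1_def T2_def T3_def T4_def
      by (rule summ)+
    have "infsum T1 UNIV - infsum T2 UNIV = (\<Sum>\<^sub>\<infinity>q\<in>UNIV. ?r1 q - T2 q)"
      using infsum_diff[OF s(1,2)] infsum_reindex_bij_betw[OF b1, of T1] by simp
    also have "\<dots> = (\<Sum>\<^sub>\<infinity>q\<in>UNIV. ?r3 q - ?r4 q)"
      by (rule infsum_cong) (auto simp: T1_def T2_def T3_def T4_def pole_term_exchange)
    also have "\<dots> = infsum T3 UNIV - infsum T4 UNIV"
      using infsum_diff[OF s(3,4)] infsum_reindex_bij_betw[OF b3, of T3]
        infsum_reindex_bij_betw[OF b4, of T4] by simp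
    finally show ?thesis .
  qed
  ultimately show ?thesis by simp
qed

end
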